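(* Let $I=[0,1)$, let $n\ge 1$, let $-1<\lambda<1$ and let $f:I\to\mathbb{R}$ be an $n$-interval piecewise $\lambda$-affine map. Then, for Lebesgue almost every $\delta\in\mathbb{R}$, the map $f_\delta:I\to I$, $f_\delta=f+\delta\ (\mathrm{mod}\ 1)$, is asymptotically periodic and has at most $2n$ periodic orbits.
   Context: A map $f:I=[0,1)\to\mathbb{R}$ is an $n$-interval piecewise $\lambda$-affine map if there exist points $0=c_0<c_1<\cdots<c_{n-1}<c_n=1$ and real numbers $b_1,\ldots,b_n$ such that $f(x)=\lambda x+b_i$ for every $x\in[c_{i-1},c_i)$ and $1\le i\le n$. For $\delta\in\mathbb{R}$, $f_\delta(x)\in[0,1)$ is the fractional part of $f(x)+\delta$. For a map $g:I\to I$ and $x\in I$, the $g$-orbit of $x$ is the set $O_g(x)=\bigcup_{k\ge 0}\{g^k(x)\}$; it is called a periodic orbit if $g^k(x)=x$ for some $k\ge 1$. The $\omega$-limit set of $x$ is $\omega_g(x)=\bigcap_{m\ge 0}\overline{\bigcup_{k\ge m}\{g^k(x)\}}$ (closure in $\mathbb{R}$). The map $g$ is asymptotically periodic if $\omega_g(x)$ is a periodic orbit of $g$ for every $x\in I$. *)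

theory Defs
  imports "HOL-Analysis.Analysis"
begin

text \<open>
  Maps on \<open>I = [0,1)\<close> are total functions \<open>real \<Rightarrow> real\<close>; their values outside
  \<open>{0..<1}\<close> play no role in any of the definitions below.
\<close>

definition piecewise_affine :: "nat \<Rightarrow> real \<Rightarrow> (real \<Rightarrow> real) \<Rightarrow> bool" where
  "piecewise_affine n lam f \<longleftrightarrow>
     (\<exists>c b :: nat \<Rightarrow> real.
        c 0 = 0 \<and> c n = 1 \<and> (\<forall>i\<in>{1..n}. c (i - 1) < c i) \<and>
        (\<forall>i\<in>{1..n}. \<forall>x\<in>{c (i - 1)..<c i}. f x = lam * x + b i))"

definition shift_mod1 :: "(real \<Rightarrow> real) \<Rightarrow> real \<Rightarrow> real \<Rightarrow> real" where
  "shift_mod1 f \<delta> x = frac (f x + \<delta>)"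

text \<open>The orbit includes its starting point.\<close>

definition forward_orbit :: "('a \<Rightarrow> 'a) \<Rightarrow> 'a \<Rightarrow> 'a set" where
  "forward_orbit g x = (\<Union>k. {(g ^^ k) x})"

definition periodic_orbits :: "(real \<Rightarrow> real) \<Rightarrow> real set set" where
  "periodic_orbits g =
     {forward_orbit g x | x. x \<in> {0..<1} \<and> (\<exists>k\<ge>1. (g ^^ k) x = x)}"

text \<open>The closure is taken in the whole space, so for a map on \<open>I\<close> it may contain the point 1.\<close>

definition omega_limit :: "('a::topological_space \<Rightarrow> 'a) \<Rightarrow> 'a \<Rightarrow> 'a set" where
  "omega_limit g x = (\<Inter>m. closure (\<Union>k\<in>{m..}. {(g ^^ k) x}))"

definition asymptotically_periodic :: "(real \<Rightarrow> real) \<Rightarrow> bool" where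
  "asymptotically_periodic g \<longleftrightarrow> (\<forall>x\<in>{0..<1}. omega_limit g x \<in> periodic_orbits g)"

end

theory Submission
  imports Defs
begin

text \<open>
  Write \<open>g\<close> for the map at parameter \<open>\<delta>\<close>. On each piece it acts by one of the countably many
  contractions \<open>x \<mapsto> \<lambda> x + b i + \<delta> - m\<close>, with \<open>i\<close> the piece and \<open>m\<close> the integer part removed,
  so \<open>g ^^ k\<close> is described by words of length \<open>k\<close> in the letters \<open>(i, m)\<close>. The jumps of \<open>g\<close> at the
  preimages of integers need no separate treatment: the two one-sided limits of \<open>g\<close> there are
  \<open>0 = c 0\<close> and \<open>1 = c n\<close>, so an orbit whose future keeps away from all breakpoints
  \<open>c 0, ..., c n\<close> keeps away from these jumps as well.

  \<^emph>\<open>Dynamics away from the breakpoints.\<close> Suppose that for some \<open>k\<close> the image of \<open>g ^^ k\<close> has distance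
  at least \<open>r > 0\<close> from all breakpoints. Then any point closer than \<open>r\<close> to such an orbit shadows
  it, the difference being multiplied by \<open>\<lambda>\<close> at each step (\<open>shadow\<close>). An orbit in a bounded interval
  comes back close to itself, and the fixed point equation of the return branch then has a solution
  near the orbit; that solution is a periodic point which attracts the orbit
  (\<open>attracted_to_periodic_point\<close>). For the count, assign to a periodic orbit the breakpoint that is
  closest to it, together with the side on which the closest orbit point lies. The whole interval
  between the two is attracted to the orbit, so distinct orbits get distinct pairs; each of the
  \<open>n\<close> breakpoints of the circle has two sides, whence at most \<open>2 n\<close> orbits
  (\<open>card_periodic_orbits\<close>).

  \<^emph>\<open>Almost every parameter has this property.\<close> The image of \<open>I\<close> under a word of length \<open>k\<close> is an
  interval of length \<open>\<bar>\<lambda>\<bar> ^ k\<close> which moves, as \<open>\<delta>\<close> varies, at a speed bounded away from \<open>0\<close>. So the set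
  of \<open>\<delta>\<close> for which it meets a given breakpoint has measure \<open>O(\<bar>\<lambda>\<bar> ^ k)\<close>, and it remains to bound the number
  of words of length \<open>k\<close> that occur for \<open>\<delta>\<close> in a small neighbourhood. There are only countably many
  \<open>\<delta>\<close> for which a word maps a breakpoint to a breakpoint. For any other \<open>\<delta>\<^sub>0\<close> the forward branches
  from a point meet breakpoints at most once, so at most two words of length \<open>N\<close> can be read from it,
  whatever \<open>N\<close> is (\<open>at_most_two_words\<close>). By compactness this persists for
  \<open>\<delta>\<close> near \<open>\<delta>\<^sub>0\<close> and for all starting points in a short interval, so the number of words of
  length \<open>K + j N\<close> is \<open>O(2 ^ j)\<close> (\<open>few_words_near_generic\<close>). With \<open>2 \<bar>\<lambda>\<bar> ^ N < 1\<close> the total measure tends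
  to \<open>0\<close>, and the exceptional parameters are locally, hence globally, negligible.
\<close>

section \<open>Pieces, branches and words\<close>

locale piecewise_contraction =
  fixes n :: nat and lam :: real and c b :: "nat \<Rightarrow> real" and f :: "real \<Rightarrow> real"
  assumes lam: "\<bar>lam\<bar> < 1"
    and c_0: "c 0 = 0" and c_n: "c n = 1"
    and c_step: "\<And>i. i \<in> {1..n} \<Longrightarrow> c (i - 1) < c i"
    and f_piece: "\<And>i x. i \<in> {1..n} \<Longrightarrow> x \<in> {c (i - 1)..<c i} \<Longrightarrow> f x = lam * x + b i"
begin

abbreviation g :: "real \<Rightarrow> real \<Rightarrow> real" where
  "g d \<equiv> shift_mod1 f d"

lemma c_less: "i < j \<Longrightarrow> j \<le> n \<Longrightarrow> c i < c j"
proof (induction j)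
  case (Suc j)
  have "c j < c (Suc j)" using c_step[of "Suc j"] Suc.prems by simp
  then show ?case using Suc by (cases "i = j") auto
qed simp

lemma c_le: "i \<le> j \<Longrightarrow> j \<le> n \<Longrightarrow> c i \<le> c j"
  using c_less[of i j] by (cases "i = j") auto

lemma c_range: "i \<le> n \<Longrightarrow> 0 \<le> c i" "i \<le> n \<Longrightarrow> c i \<le> 1"
  using c_le[of 0 i] c_le[of i n] c_0 c_n by auto

lemma piece_exists:
  assumes "0 \<le> x" "x < 1"
  obtains i where "i \<in> {1..n}" "c (i - 1) \<le> x" "x < c i"
proof -
  define i where "i = (LEAST i. x < c i)"
  have "x < c n" using assms c_n by simp
  then have i: "x < c i" "i \<le> n"
    unfolding i_def by (auto intro: LeastI Least_le)
  have "i \<noteq> 0" using i assms c_0 by (cases "i = 0") auto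
  moreover have "\<not> x < c (i - 1)"
    using not_less_Least[of "i - 1" "\<lambda>i. x < c i"] \<open>i \<noteq> 0\<close> unfolding i_def by simp
  ultimately show ?thesis using i that[of i] by auto
qed

lemma piece_unique:
  assumes "x \<notin> c ` {..n}" "i \<in> {1..n}" "c (i - 1) \<le> x" "x \<le> c i"
    "j \<in> {1..n}" "c (j - 1) \<le> x" "x \<le> c j"
  shows "i = j"
proof -
  have "\<not> i < j" if "i \<in> {1..n}" "x \<le> c i" "j \<in> {1..n}" "c (j - 1) \<le> x" for i j
  proof
    assume "i < j"
    then have "c i \<le> c (j - 1)" using that by (intro c_le) auto
    then have "x = c i" using that by simp
    then show False using assms(1) that by auto
  qed
  from this[of i j] this[of j i] show ?thesis using assms by auto
qed

text \<open>
  A letter \<open>(i, m)\<close> records the piece used and the integer subtracted to return to the unit interval.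
\<close>

fun branch :: "real \<Rightarrow> nat \<times> int \<Rightarrow> real \<Rightarrow> real" where
  "branch d (i, m) x = lam * x + b i + d - of_int m"

fun follow :: "real \<Rightarrow> (nat \<times> int) list \<Rightarrow> real \<Rightarrow> real" where
  "follow d [] x = x"
| "follow d (a # w) x = follow d w (branch d a x)"

text \<open>
  Closed pieces are used, and the final point may be any point of \<open>[0,1]\<close>, so that admissibility of
  a word is a closed condition on the pair of parameter and point. At a jump, the
  words of both one-sided branches are admissible.
\<close>

fun admissible :: "real \<Rightarrow> real \<Rightarrow> (nat \<times> int) list \<Rightarrow> bool" where
  "admissible d x [] \<longleftrightarrow> 0 \<le> x \<and> x \<le> 1"
| "admissible d x ((i, m) # w) \<longleftrightarrow>
     i \<in> {1..n} \<and> c (i - 1) \<le> x \<and> x \<le> c i \<and> admissible d (branch d (i, m) x) w"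

lemma admissible_range:
  assumes "admissible d x w" shows "0 \<le> x" "x \<le> 1"
proof -
  have "0 \<le> x \<and> x \<le> 1"
  proof (cases w)
    case Nil
    then show ?thesis using assms by simp
  next
    case (Cons a v)
    obtain i m where a: "a = (i, m)" by force
    have "i \<in> {1..n}" "c (i - 1) \<le> x" "x \<le> c i" using assms Cons a by auto
    moreover from this have "i - 1 \<le> n" "i \<le> n" by auto
    ultimately show ?thesis using c_range(1)[of "i - 1"] c_range(2)[of i] by linarith
  qed
  then show "0 \<le> x" "x \<le> 1" by auto
qed

lemma follow_append: "follow d (u @ v) x = follow d v (follow d u x)"
  by (induction u arbitrary: x) auto

lemma admissible_append: "admissible d x (u @ v) \<Longrightarrow> admissible d x u \<and> admissible d (follow d u x) v"
proof (induction u arbitrary: x)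
  case Nil
  then show ?case using admissible_range by auto
next
  case (Cons a u)
  then show ?case by (cases a) auto
qed

lemma orbit_admissible:
  assumes "x \<in> {0..<1}"
  shows "\<exists>w. length w = k \<and> admissible d x w \<and> follow d w x = (g d ^^ k) x"
  using assms
proof (induction k arbitrary: x)
  case 0
  then show ?case by (intro exI[of _ "[]"]) auto
next
  case (Suc k)
  obtain i where i: "i \<in> {1..n}" "c (i - 1) \<le> x" "x < c i"
    using piece_exists Suc.prems by auto
  define m where "m = \<lfloor>f x + d\<rfloor>"
  have fx: "f x = lam * x + b i" using f_piece i by simp
  have gx: "g d x = branch d (i, m) x"
    by (simp add: shift_mod1_def frac_def m_def fx)
  have "g d x \<in> {0..<1}" by (simp add: shift_mod1_def frac_lt_1)
  from Suc.IH[OF this] obtain w where "length w = k" "admissible d (g d x) w"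
    "follow d w (g d x) = (g d ^^ k) (g d x)" by blast
  then show ?case using i gx
    by (intro exI[of _ "(i, m) # w"]) (auto simp: funpow_Suc_right simp del: funpow.simps)
qed

text \<open>
  The derivative of the \<open>k\<close>-th iterate with respect to the parameter, the same for all words of length \<open>k\<close>.
\<close>

definition speed :: "nat \<Rightarrow> real" where
  "speed k = (\<Sum>j<k. lam ^ j)"

lemma speed_closed_form: "speed k = (1 - lam ^ k) / (1 - lam)"
  using lam geometric_sum[of lam k] unfolding speed_def
  by (simp add: divide_simps) (auto simp: algebra_simps)

lemma abs_lam_power_le: "k > 0 \<Longrightarrow> \<bar>lam ^ k\<bar> \<le> \<bar>lam\<bar>"
  using lam power_decreasing[of 1 k "\<bar>lam\<bar>"] by (simp add: power_abs)

lemma speed_lower: "k > 0 \<Longrightarrow> (1 - \<bar>lam\<bar>) / 2 \<le> speed k"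
proof -
  assume "k > 0"
  then have "1 - \<bar>lam\<bar> \<le> 1 - lam ^ k" using abs_lam_power_le[of k] by linarith
  then show ?thesis unfolding speed_closed_form using lam by (intro frac_le) auto
qed

lemma speed_upper: "\<bar>speed k\<bar> \<le> 2 / (1 - \<bar>lam\<bar>)"
proof -
  have "\<bar>lam ^ k\<bar> \<le> 1" using lam by (simp add: power_abs power_le_one)
  then have "\<bar>1 - lam ^ k\<bar> \<le> 2" by linarith
  moreover have "\<bar>speed k\<bar> = \<bar>1 - lam ^ k\<bar> / (1 - lam)"
    unfolding speed_closed_form using lam by (simp add: abs_divide)
  ultimately show ?thesis using lam by (auto intro!: frac_le)
qed

lemma follow_affine:
  "\<exists>\<beta>. \<forall>d x. follow d w x = lam ^ length w * x + \<beta> + speed (length w) * d"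
proof (induction w)
  case Nil
  then show ?case by (auto simp: speed_def)
next
  case (Cons a w)
  obtain i m where a: "a = (i, m)" by force
  from Cons obtain \<beta> where
    "\<forall>d x. follow d w x = lam ^ length w * x + \<beta> + speed (length w) * d" by blast
  then show ?case
    by (intro exI[of _ "lam ^ length w * (b i - of_int m) + \<beta>"])
       (simp add: a speed_def algebra_simps)
qed

section \<open>Words at a generic parameter\<close>

definition generic :: "real \<Rightarrow> bool" where
  "generic d \<longleftrightarrow> (\<forall>w i j. w \<noteq> [] \<longrightarrow> i \<le> n \<longrightarrow> j \<le> n \<longrightarrow> follow d w (c i) \<noteq> c j)"

text \<open>
  For a fixed word, \<open>follow d w x\<close> is affine in \<open>d\<close> with nonzero slope, so each coincidence of
  breakpoints excludes a single parameter.
\<close>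

lemma countable_not_generic: "countable {d. \<not> generic d}"
proof -
  have "{d. \<not> generic d} \<subseteq>
    (\<Union>w\<in>{w. w \<noteq> []}. \<Union>i\<in>{..n}. \<Union>j\<in>{..n}. {d. follow d w (c i) = c j})"
    unfolding generic_def by auto
  moreover have "countable {d. follow d w x = y}" if "w \<noteq> []" for w x y
  proof -
    obtain \<beta> where \<beta>: "\<forall>d x. follow d w x = lam ^ length w * x + \<beta> + speed (length w) * d"
      using follow_affine by blast
    have "speed (length w) > 0" using speed_lower[of "length w"] that lam by fastforce
    then have "{d. follow d w x = y} \<subseteq> {(y - lam ^ length w * x - \<beta>) / speed (length w)}"
      using \<beta> by (auto simp: field_simps)
    then show ?thesis by (rule countable_subset) simp
  qed
  ultimately show ?thesis
    by (elim countable_subset) (intro countable_UN, auto)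
qed

text \<open>
  An affine image can be moved into \<open>[0,1]\<close> by two different integers only if it is itself an
  integer, that is, only if it lands on one of the breakpoints \<open>0\<close> and \<open>1\<close>.
\<close>

lemma letter_shift_unique:
  assumes "0 \<le> branch d (i, m) x" "branch d (i, m) x \<le> 1"
    "0 \<le> branch d (i, m') x" "branch d (i, m') x \<le> 1"
  shows "m' = m \<or> (branch d (i, m) x = 0 \<and> m' = m - 1) \<or> (branch d (i, m) x = 1 \<and> m' = m + 1)"
proof -
  have "\<bar>real_of_int m - real_of_int m'\<bar> \<le> 1" using assms by auto
  then have "m' \<in> {m - 1, m, m + 1}" by auto
  then show ?thesis using assms by auto
qed

text \<open>
  A word continuing from the image of a breakpoint offers a choice only when it meets a breakpoint,
  either to choose a piece or to choose an integer. Genericity forbids a second meeting.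
\<close>

lemma word_unique_after_breakpoint:
  assumes "generic d" "u \<noteq> []" "i \<le> n"
    "length v = length w" "admissible d (follow d u (c i)) v" "admissible d (follow d u (c i)) w"
  shows "v = w"
  using assms(2-)
proof (induction v w arbitrary: u rule: list_induct2')
  case (4 a v a' w)
  obtain j m j' m' where a: "a = (j, m)" "a' = (j', m')" by (metis surj_pair)
  let ?y = "follow d u (c i)"
  have nb: "follow d u' (c i) \<notin> c ` {..n}" if "u' \<noteq> []" for u'
    using assms(1) that 4(3) unfolding generic_def by auto
  have "j = j'"
    using piece_unique[OF nb[OF 4(2)], of j j'] 4 a by simp
  have y': "branch d (j, k) ?y = follow d (u @ [(j, k)]) (c i)" for k
    by (simp add: follow_append)
  have "0 \<in> c ` {..n}" "1 \<in> c ` {..n}" using c_0 c_n by force+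
  then have "branch d (j, m) ?y \<noteq> 0" "branch d (j, m) ?y \<noteq> 1"
    unfolding y' using nb[of "u @ [(j, m)]"] by (metis snoc_eq_iff_butlast)+
  moreover have admissible': "admissible d (branch d (j, m) ?y) v" "admissible d (branch d (j, m') ?y) w"
    using 4 a \<open>j = j'\<close> by auto
  ultimately have "m' = m"
    using letter_shift_unique[of d j m ?y m'] admissible_range by metis
  then have "v = w"
    using 4(1)[of "u @ [(j, m)]"] 4 admissible' unfolding y' by simp
  then show ?case using a \<open>j = j'\<close> \<open>m' = m\<close> by simp
qed auto

lemma word_determined_at_breakpoint:
  assumes gen: "generic d" and i: "i \<le> n" and len: "length v = length w"
    and admissible: "admissible d (c i) ((j, m) # v)" "admissible d (c i) ((j, m') # w)"
  shows "m = m' \<and> v = w"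
proof -
  have nb: "branch d (j, m) (c i) \<notin> c ` {..n}"
  proof
    assume "branch d (j, m) (c i) \<in> c ` {..n}"
    then obtain i' where "i' \<le> n" "follow d [(j, m)] (c i) = c i'" by auto
    then show False using gen i unfolding generic_def by blast
  qed
  have "0 \<in> c ` {..n}" "1 \<in> c ` {..n}" using c_0 c_n by force+
  then have "branch d (j, m) (c i) \<noteq> 0" "branch d (j, m) (c i) \<noteq> 1" using nb by metis+
  moreover have admissible': "admissible d (branch d (j, m) (c i)) v" "admissible d (branch d (j, m') (c i)) w"
    using admissible by auto
  ultimately have "m' = m"
    using letter_shift_unique[of d j m "c i" m'] admissible_range by metis
  then show ?thesis
    using word_unique_after_breakpoint[OF gen, of "[(j, m)]" i v w] i len admissible' by simp
qed

lemma breakpoint_adjacent_piece: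
  assumes "i \<le> n" "j \<in> {1..n}" "c (j - 1) \<le> c i" "c i \<le> c j"
  shows "j = i \<or> j = Suc i"
proof -
  have "\<not> j < i" using c_less[of j i] assms by auto
  moreover have "\<not> i < j - 1" using c_less[of i "j - 1"] assms by force
  ultimately show ?thesis by linarith
qed

lemma word_unique_at_endpoint:
  assumes "generic d" "i = 0 \<or> i = n" "length v = length w" "admissible d (c i) v" "admissible d (c i) w"
  shows "v = w"
proof (cases v)
  case Nil
  then show ?thesis using assms by simp
next
  case (Cons a v')
  then obtain a' w' where w: "w = a' # w'" using assms by (cases w) auto
  obtain j m j' m' where a: "a = (j, m)" "a' = (j', m')" by (metis surj_pair)
  have "j = j'"
    using breakpoint_adjacent_piece[of i j] breakpoint_adjacent_piece[of i j'] assms Cons w a by auto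
  then show ?thesis
    using word_determined_at_breakpoint[of d i v' w' j m m'] assms Cons w a by auto
qed

text \<open>
  The only choice along a word is made at the first meeting with a breakpoint: either between
  the two pieces adjacent to it, or between the two integers that place an image at \<open>0\<close> or at \<open>1\<close>.
  Both endpoints adjoin a single piece, so the second kind of choice is not followed by another one.
\<close>

lemma at_most_two_words:
  assumes "generic d"
  shows "\<exists>u v. \<forall>w. length w = N \<longrightarrow> admissible d x w \<longrightarrow> w \<in> {u, v}"
proof (induction N arbitrary: x)
  case 0
  then show ?case by auto
next
  case (Suc N)
  show ?case
  proof (cases "x \<in> c ` {..n}")
    case True
    then obtain i where i: "i \<le> n" "x = c i" by auto
    \<comment> \<open>At a breakpoint the first piece determines the word, so any choice picks the right one.\<close>
    define word where "word j = (SOME w. length w = Suc N \<and> admissible d x w \<and> fst (hd w) = j)" for j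
    have "w \<in> {word i, word (Suc i)}" if w: "length w = Suc N" "admissible d x w" for w
    proof -
      obtain j m v where wv: "w = (j, m) # v" using w by (metis length_Suc_conv surj_pair)
      have "length (word j) = Suc N \<and> admissible d x (word j) \<and> fst (hd (word j)) = j"
        unfolding word_def by (rule someI[of _ w]) (use w wv in auto)
      moreover from this obtain m' v' where "word j = (j, m') # v'"
        by (metis length_Suc_conv surj_pair list.sel(1) fst_conv)
      ultimately have "w = word j"
        using word_determined_at_breakpoint[OF assms i(1), of v v' j m m'] w wv i by auto
      moreover have "j = i \<or> j = Suc i"
        using breakpoint_adjacent_piece[of i j] i w wv by auto
      ultimately show ?thesis by auto
    qed
    then show ?thesis by blast
  next
    case nb: False
    show ?thesis
    proof (cases "\<exists>w. length w = Suc N \<and> admissible d x w")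
      case False
      then show ?thesis by blast
    next
      case True
      then obtain i m w0 where w0: "length w0 = N" "admissible d x ((i, m) # w0)"
        by (metis length_Suc_conv surj_pair)
      have first: "\<exists>m' v. w = (i, m') # v \<and> length v = N \<and> admissible d (branch d (i, m') x) v"
        if w: "length w = Suc N" "admissible d x w" for w
      proof -
        obtain j m' v where wv: "w = (j, m') # v" using w by (metis length_Suc_conv surj_pair)
        have "j = i" using piece_unique[OF nb, of j i] w wv w0 by auto
        then show ?thesis using w wv by auto
      qed
      have adm0: "admissible d (branch d (i, m) x) w0" using w0 by simp
      show ?thesis
      proof (cases "branch d (i, m) x \<in> {0, 1}")
        case False
        obtain u v where uv: "\<forall>w. length w = N \<longrightarrow> admissible d (branch d (i, m) x) w \<longrightarrow> w \<in> {u, v}"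
          using Suc.IH by blast
        have "w \<in> {(i, m) # u, (i, m) # v}" if w: "length w = Suc N" "admissible d x w" for w
        proof -
          obtain m' v' where w': "w = (i, m') # v'" "length v' = N" "admissible d (branch d (i, m') x) v'"
            using first w by blast
          have "m' = m"
            using letter_shift_unique[of d i m x m'] admissible_range[OF adm0] admissible_range[OF w'(3)] False by auto
          then show ?thesis using uv w' by auto
        qed
        then show ?thesis by blast
      next
        case True
        \<comment> \<open>The first image is \<open>0\<close> or \<open>1\<close>, so here the first integer determines the word.\<close>
        define word where "word k = (SOME w. length w = Suc N \<and> admissible d x w \<and> snd (hd w) = k)" for k
        have integral: "branch d (i, m') x = c 0 \<or> branch d (i, m') x = c n"
          if "admissible d (branch d (i, m') x) v" for m' v
          using letter_shift_unique[of d i m x m'] admissible_range[OF adm0] admissible_range[OF that] True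
          by (auto simp: c_0 c_n)
        define m1 where "m1 = (if branch d (i, m) x = 0 then m - 1 else m + 1)"
        have "w \<in> {word m, word m1}" if w: "length w = Suc N" "admissible d x w" for w
        proof -
          obtain m' v' where w': "w = (i, m') # v'" "length v' = N" "admissible d (branch d (i, m') x) v'"
            using first w by blast
          have word: "length (word m') = Suc N \<and> admissible d x (word m') \<and> snd (hd (word m')) = m'"
            unfolding word_def by (rule someI[of _ w]) (use w w' in auto)
          obtain k v'' where "word m' = (i, k) # v''" "length v'' = N"
              "admissible d (branch d (i, k) x) v''"
            using first[of "word m'"] word by blast
          with word have w'': "word m' = (i, m') # v''" "length v'' = N"
              "admissible d (branch d (i, m') x) v''"
            by simp_all
          have "v' = v''"
            using integral[OF w'(3)] word_unique_at_endpoint[OF assms, of 0 v' v'']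
              word_unique_at_endpoint[OF assms, of n v' v''] w' w'' by auto
          then have "w = word m'" using w' w'' by simp
          moreover have "m' \<in> {m, m1}"
            using letter_shift_unique[of d i m x m'] admissible_range[OF adm0] admissible_range[OF w'(3)] True
            unfolding m1_def by auto
          ultimately show ?thesis by auto
        qed
        then show ?thesis by blast
      qed
    qed
  qed
qed


section \<open>Counting words for nearby parameters\<close>

lemma closed_admissible: "closed {p :: real \<times> real. admissible (fst p) (snd p) w}"
proof -
  have "closed {p :: real \<times> real. admissible (fst p) (h p) w}" if "continuous_on UNIV h" for h
    using that
  proof (induction w arbitrary: h)
    case Nil
    then show ?case
      by (auto intro!: closed_Collect_conj closed_Collect_le continuous_intros)
  next
    case (Cons a w)
    obtain i m where a: "a = (i, m)" by force
    have "continuous_on UNIV (\<lambda>p. branch (fst p) (i, m) (h p))"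
      unfolding branch.simps by (intro continuous_intros Cons.prems)
    from Cons.IH[OF this] show ?case unfolding a admissible.simps
      by (intro closed_Collect_conj closed_Collect_le closed_Collect_const continuous_intros Cons.prems)
  qed
  then show ?thesis by (simp add: continuous_on_snd)
qed

lemma finite_admissible_words:
  "finite {w. length w = N \<and> (\<exists>d x. \<bar>d\<bar> \<le> D \<and> admissible d x w)}"
proof -
  define M where "M = \<lceil>2 + (\<Sum>i\<le>n. \<bar>b i\<bar>) + D\<rceil>"
  define L where "L = {1..n} \<times> {- M..M}"
  have "set w \<subseteq> L" if "\<bar>d\<bar> \<le> D" "admissible d x w" for d x w
    using that(2)
  proof (induction w arbitrary: x)
    case (Cons a w)
    obtain i m where a: "a = (i, m)" by force
    have next_adm: "admissible d (branch d (i, m) x) w" and i: "i \<in> {1..n}" using Cons a by auto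
    have "\<bar>lam * x\<bar> \<le> 1"
      using lam admissible_range[OF Cons.prems] by (simp add: abs_mult mult_le_one)
    moreover have "\<bar>b i\<bar> \<le> (\<Sum>i\<le>n. \<bar>b i\<bar>)"
      using i by (intro member_le_sum) auto
    moreover have "\<bar>lam * x + b i + d - m\<bar> \<le> 1"
      using admissible_range[OF next_adm] by simp
    ultimately have "\<bar>real_of_int m\<bar> \<le> 2 + (\<Sum>i\<le>n. \<bar>b i\<bar>) + D"
      using that(1) by linarith
    then have "\<bar>m\<bar> \<le> M" unfolding M_def by linarith
    then have "a \<in> L" using i a by (auto simp: L_def)
    then show ?case using Cons.IH[OF next_adm] by simp
  qed simp
  then have "{w. length w = N \<and> (\<exists>d x. \<bar>d\<bar> \<le> D \<and> admissible d x w)} \<subseteq> {w. set w \<subseteq> L \<and> length w = N}"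
    by auto
  moreover have "finite {w. set w \<subseteq> L \<and> length w = N}"
    by (rule finite_lists_length_eq) (simp add: L_def)
  ultimately show ?thesis by (rule finite_subset)
qed

text \<open>
  Admissibility is closed and only finitely many words of length \<open>N\<close> occur, so near a pair
  \<open>(d0, y)\<close> no words appear beyond those admissible at that pair. A Lebesgue number
  for the resulting cover of \<open>{d0} \<times> {0..1}\<close> makes the neighbourhoods uniform.
\<close>

lemma at_most_two_words_nearby:
  assumes "generic d0"
  obtains r where "r > 0"
    "\<And>S. (\<And>y z. y \<in> S \<Longrightarrow> z \<in> S \<Longrightarrow> \<bar>y - z\<bar> < r) \<Longrightarrow>
       \<exists>u v. \<forall>w d y. length w = N \<longrightarrow> \<bar>d - d0\<bar> < r \<longrightarrow> y \<in> S \<longrightarrow> admissible d y w \<longrightarrow> w \<in> {u, v}"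
proof -
  define L where "L = {w. length w = N \<and> (\<exists>d x. \<bar>d\<bar> \<le> \<bar>d0\<bar> + 1 \<and> admissible d x w)}"
  define V where "V y = - (\<Union>w\<in>{w\<in>L. \<not> admissible d0 y w}. {p. admissible (fst p) (snd p) w})" for y
  have "finite L" unfolding L_def by (rule finite_admissible_words)
  then have open_V: "open (V y)" for y
    unfolding V_def by (intro open_Compl closed_UN closed_admissible ballI) auto
  have "compact ({d0} \<times> {0..1::real})" by (intro compact_Times) auto
  moreover have "{d0} \<times> {0..1} \<subseteq> \<Union> (range V)" by (auto simp: V_def)
  ultimately obtain e where e: "e > 0"
    "\<And>p. p \<in> {d0} \<times> {0..1} \<Longrightarrow> \<exists>G\<in>range V. ball p e \<subseteq> G"
    using Heine_Borel_lemma[of "{d0} \<times> {0..1}" "range V"] open_V by blast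
  define r where "r = min 1 (e / 2)"
  have "\<exists>u v. \<forall>w d y. length w = N \<longrightarrow> \<bar>d - d0\<bar> < r \<longrightarrow> y \<in> S \<longrightarrow> admissible d y w \<longrightarrow> w \<in> {u, v}"
    if S: "\<And>y z. y \<in> S \<Longrightarrow> z \<in> S \<Longrightarrow> \<bar>y - z\<bar> < r" for S
  proof (cases "\<exists>w d y. y \<in> S \<and> admissible d y w")
    case False
    then show ?thesis by blast
  next
    case True
    then obtain w1 d1 y1 where y1: "y1 \<in> S" "admissible d1 y1 w1" by blast
    then have "(d0, y1) \<in> {d0} \<times> {0..1}" using admissible_range[OF y1(2)] by simp
    from e(2)[OF this] obtain y0 where y0: "ball (d0, y1) e \<subseteq> V y0" by blast
    obtain u v where uv: "\<forall>w. length w = N \<longrightarrow> admissible d0 y0 w \<longrightarrow> w \<in> {u, v}"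
      using at_most_two_words[OF assms] by blast
    have "w \<in> {u, v}" if w: "length w = N" "\<bar>d - d0\<bar> < r" "y \<in> S" "admissible d y w" for w d y
    proof -
      have "dist (d0, y1) (d, y) \<le> \<bar>d - d0\<bar> + \<bar>y - y1\<bar>"
        using sqrt_sum_squares_le_sum_abs[of "d - d0" "y - y1"]
        by (simp add: dist_Pair_Pair dist_real_def power2_commute)
      also have "\<dots> < e" using w S[OF w(3) y1(1)] by (simp add: r_def)
      finally have "(d, y) \<in> V y0" using y0 by (auto simp: subset_iff)
      moreover have "r \<le> 1" by (simp add: r_def)
      then have "\<bar>d\<bar> \<le> \<bar>d0\<bar> + 1" using w(2) by linarith
      then have "w \<in> L" using w unfolding L_def by blast
      ultimately have "admissible d0 y0 w" using w(4) by (auto simp: V_def)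
      then show ?thesis using uv w(1) by blast
    qed
    then show ?thesis by blast
  qed
  moreover have "r > 0" using e by (simp add: r_def)
  ultimately show ?thesis using that by blast
qed

definition words_near :: "real \<Rightarrow> real \<Rightarrow> nat \<Rightarrow> (nat \<times> int) list set" where
  "words_near d0 e k = {w. length w = k \<and> (\<exists>d x. \<bar>d - d0\<bar> < e \<and> admissible d x w)}"

lemma finite_words_near: "finite (words_near d0 e k)"
proof (rule finite_subset[OF _ finite_admissible_words[of k "\<bar>d0\<bar> + e"]])
  have "\<bar>d - d0\<bar> < e \<Longrightarrow> \<bar>d\<bar> \<le> \<bar>d0\<bar> + e" for d by linarith
  then show "words_near d0 e k \<subseteq> {w. length w = k \<and> (\<exists>d x. \<bar>d\<bar> \<le> \<bar>d0\<bar> + e \<and> admissible d x w)}"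
    unfolding words_near_def by blast
qed

lemma follow_dist:
  assumes "x \<in> {0..1}" "y \<in> {0..1}"
  shows "\<bar>follow d w x - follow d' w y\<bar> \<le> \<bar>lam\<bar> ^ length w + 2 / (1 - \<bar>lam\<bar>) * \<bar>d - d'\<bar>"
proof -
  obtain \<beta> where \<beta>: "\<forall>d x. follow d w x = lam ^ length w * x + \<beta> + speed (length w) * d"
    using follow_affine by blast
  have "follow d w x - follow d' w y = lam ^ length w * (x - y) + speed (length w) * (d - d')"
    unfolding \<beta>[rule_format] by (simp add: algebra_simps)
  also have "\<bar>\<dots>\<bar> \<le> \<bar>lam ^ length w * (x - y)\<bar> + \<bar>speed (length w) * (d - d')\<bar>"
    by (rule abs_triangle_ineq)
  also have "\<bar>lam ^ length w * (x - y)\<bar> \<le> \<bar>lam\<bar> ^ length w * 1"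
    unfolding abs_mult power_abs using assms by (intro mult_left_mono) auto
  also have "\<bar>speed (length w) * (d - d')\<bar> \<le> 2 / (1 - \<bar>lam\<bar>) * \<bar>d - d'\<bar>"
    unfolding abs_mult by (intro mult_right_mono speed_upper) auto
  finally show ?thesis by simp
qed

text \<open>
  A long word collapses \<open>[0,1]\<close> to a very short interval, which also moves little while the parameter
  stays within \<open>e\<close> of \<open>d0\<close>. All points reached by the word thus lie in a short set, from which at most
  two words of length \<open>N\<close> continue: each further \<open>N\<close> letters at most double the number of words.
\<close>

lemma few_words_near_generic:
  assumes "generic d0"
  obtains e K C where "e > 0" "\<And>j. card (words_near d0 e (K + j * N)) \<le> C * 2 ^ j"
proof -
  obtain r where r: "r > 0"
    "\<And>S. (\<And>y z. y \<in> S \<Longrightarrow> z \<in> S \<Longrightarrow> \<bar>y - z\<bar> < r) \<Longrightarrow>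
       \<exists>u v. \<forall>w d y. length w = N \<longrightarrow> \<bar>d - d0\<bar> < r \<longrightarrow> y \<in> S \<longrightarrow> admissible d y w \<longrightarrow> w \<in> {u, v}"
    using at_most_two_words_nearby[OF assms, where N = N] by blast
  obtain K where K: "\<bar>lam\<bar> ^ K < r / 2"
    using real_arch_pow_inv[of "r / 2" "\<bar>lam\<bar>"] r lam by auto
  \<comment> \<open>Two parameters within \<open>e\<close> of \<open>d0\<close> differ by less than \<open>2 e\<close>, and the speed is at most
    \<open>2 / (1 - \<bar>lam\<bar>)\<close>; the constant leaves one half of \<open>r\<close> to the length of the image.\<close>
  define e where "e = r * (1 - \<bar>lam\<bar>) / 8"
  have e: "e > 0" "e \<le> r" "2 / (1 - \<bar>lam\<bar>) * (2 * e) \<le> r / 2"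
    using r(1) lam by (auto simp: e_def field_simps)
  have double: "card (words_near d0 e (k + N)) \<le> card (words_near d0 e k) * 2" if k: "k \<ge> K" for k
  proof -
    define S where "S u = {follow d u x | d x. \<bar>d - d0\<bar> < e \<and> x \<in> {0..1}}" for u
    have "\<exists>v v'. \<forall>w d y. length w = N \<longrightarrow> \<bar>d - d0\<bar> < r \<longrightarrow> y \<in> S u \<longrightarrow> admissible d y w \<longrightarrow> w \<in> {v, v'}"
      if u: "length u = k" for u
    proof (rule r(2))
      fix y z assume "y \<in> S u" "z \<in> S u"
      then obtain d x d' x' where yz: "y = follow d u x" "\<bar>d - d0\<bar> < e" "x \<in> {0..1}"
        "z = follow d' u x'" "\<bar>d' - d0\<bar> < e" "x' \<in> {0..1}" unfolding S_def by blast
      have "\<bar>y - z\<bar> \<le> \<bar>lam\<bar> ^ k + 2 / (1 - \<bar>lam\<bar>) * \<bar>d - d'\<bar>"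
        using follow_dist[of x x' d u d'] yz u by simp
      also have "\<bar>lam\<bar> ^ k \<le> \<bar>lam\<bar> ^ K" using k lam by (intro power_decreasing) auto
      also have "2 / (1 - \<bar>lam\<bar>) * \<bar>d - d'\<bar> \<le> 2 / (1 - \<bar>lam\<bar>) * (2 * e)"
        using yz lam by (intro mult_left_mono) auto
      finally show "\<bar>y - z\<bar> < r" using K e(3) by linarith
    qed
    then obtain v v' where v: "\<And>u w d y. length u = k \<Longrightarrow> length w = N \<Longrightarrow> \<bar>d - d0\<bar> < r \<Longrightarrow>
        y \<in> S u \<Longrightarrow> admissible d y w \<Longrightarrow> w \<in> {v u, v' u}"
      by metis
    have "words_near d0 e (k + N) \<subseteq> (\<Union>u\<in>words_near d0 e k. {u @ v u, u @ v' u})"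
    proof
      fix w assume "w \<in> words_near d0 e (k + N)"
      then obtain d x where w: "length w = k + N" "\<bar>d - d0\<bar> < e" "admissible d x w"
        unfolding words_near_def by blast
      define u t where "u = take k w" and "t = drop k w"
      have ut: "w = u @ t" "length u = k" "length t = N" using w by (auto simp: u_def t_def)
      have admissible: "admissible d x u" "admissible d (follow d u x) t" using admissible_append w ut by auto
      have "follow d u x \<in> S u" using w(2) admissible_range[OF w(3)] by (auto simp: S_def)
      then have "t \<in> {v u, v' u}" using v[of u t d] ut admissible w(2) e(2) by simp
      moreover have "u \<in> words_near d0 e k" using admissible w ut by (auto simp: words_near_def)
      ultimately show "w \<in> (\<Union>u\<in>words_near d0 e k. {u @ v u, u @ v' u})" using ut(1) by auto
    qed
    then have "card (words_near d0 e (k + N)) \<le> card (\<Union>u\<in>words_near d0 e k. {u @ v u, u @ v' u})"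
      by (intro card_mono finite_UN_I finite_words_near) auto
    also have "\<dots> \<le> (\<Sum>u\<in>words_near d0 e k. card {u @ v u, u @ v' u})"
      by (rule card_UN_le[OF finite_words_near])
    also have "\<dots> \<le> (\<Sum>u\<in>words_near d0 e k. 2)"
      by (intro sum_mono) (simp add: card_insert_if)
    finally show ?thesis by simp
  qed
  have "card (words_near d0 e (K + j * N)) \<le> card (words_near d0 e K) * 2 ^ j" for j
  proof (induction j)
    case (Suc j)
    then show ?case using double[of "K + j * N"] by (simp add: algebra_simps)
  qed simp
  with e(1) show ?thesis using that by blast
qed

section \<open>Almost every parameter keeps a distance from the breakpoints\<close>

definition eventually_away :: "real \<Rightarrow> bool" where
  "eventually_away d \<longleftrightarrow> (\<exists>k. \<exists>\<epsilon>>0. \<forall>x\<in>{0..<1}. \<forall>i\<le>n. \<epsilon> \<le> \<bar>(g d ^^ k) x - c i\<bar>)"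

text \<open>
  The images of \<open>[0,1]\<close> under the finitely many words form a closed set containing the range of the
  \<open>k\<close>-th iterate, so if this set misses the breakpoints, it misses them by a positive distance.
\<close>

lemma follow_hits_breakpoint:
  assumes "\<not> eventually_away d" "\<bar>d - d0\<bar> < e"
  obtains w i x where "w \<in> words_near d0 e k" "i \<le> n" "x \<in> {0..1}" "follow d w x = c i"
proof -
  define A where "A = (\<Union>w\<in>words_near d0 e k. follow d w ` {0..1})"
  have "closed (follow d w ` {0..1})" for w
  proof -
    obtain \<beta> where "\<forall>d x. follow d w x = lam ^ length w * x + \<beta> + speed (length w) * d"
      using follow_affine by blast
    then show ?thesis
      by (intro compact_imp_closed compact_continuous_image) (auto intro!: continuous_intros)
  qed
  then have "closed A" unfolding A_def by (intro closed_UN finite_words_near) auto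
  have "\<exists>i\<le>n. c i \<in> A"
  proof (rule ccontr)
    assume "\<not> (\<exists>i\<le>n. c i \<in> A)"
    then have "c ` {..n} \<inter> A = {}" by auto
    then obtain \<epsilon> where "\<epsilon> > 0" "\<forall>x\<in>c ` {..n}. \<forall>y\<in>A. \<epsilon> \<le> dist x y"
      using separate_compact_closed[of "c ` {..n}" A] \<open>closed A\<close> by (auto simp: finite_imp_compact)
    moreover have "(g d ^^ k) x \<in> A" if x: "x \<in> {0..<1}" for x
    proof -
      obtain w where w: "length w = k" "admissible d x w" "follow d w x = (g d ^^ k) x"
        using orbit_admissible[OF x] by blast
      then have "w \<in> words_near d0 e k" using assms(2) by (auto simp: words_near_def)
      then show ?thesis unfolding A_def using w(3) x by force
    qed
    ultimately have "eventually_away d" unfolding eventually_away_def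
      by (intro exI[of _ k] exI[of _ \<epsilon>]) (fastforce simp: dist_real_def abs_minus_commute)
    then show False using assms(1) by simp
  qed
  then show ?thesis using that unfolding A_def by auto
qed

text \<open>
  For each of the at most \<open>C * 2 ^ j\<close> words of length \<open>k = K + j * N\<close> and each of the \<open>n + 1\<close> breakpoints,
  the parameters for which the breakpoint is hit lie in an interval of length at most
  \<open>2 * \<bar>lam\<bar> ^ k / s\<close>, where \<open>s\<close> bounds the speed from below.
\<close>

lemma negligible_not_eventually_away_near_generic:
  assumes "generic d0"
  obtains e where "e > 0" "negligible {d. \<bar>d - d0\<bar> < e \<and> \<not> eventually_away d}"
proof -
  obtain N where N: "\<bar>lam\<bar> ^ N < 1 / 2" using real_arch_pow_inv[of "1/2" "\<bar>lam\<bar>"] lam by auto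
  then have "N > 0" by (cases N) auto
  obtain e K C where e: "e > 0" "\<And>j. card (words_near d0 e (K + j * N)) \<le> C * 2 ^ j"
    using few_words_near_generic[OF assms, where N = N] by blast
  define B where "B = {d. \<bar>d - d0\<bar> < e \<and> \<not> eventually_away d}"
  define s where "s = (1 - \<bar>lam\<bar>) / 2"
  have s: "s > 0" using lam by (simp add: s_def)
  define \<rho> where "\<rho> k = \<bar>lam\<bar> ^ k / s" for k
  obtain \<beta> where \<beta>: "\<And>w d x. follow d w x = lam ^ length w * x + \<beta> w + speed (length w) * d"
    using follow_affine by metis
  define centre where "centre w i = (c i - \<beta> w) / speed (length w)" for w i
  define T where "T k = (\<Union>p\<in>words_near d0 e k \<times> {..n}.
    cball (centre (fst p) (snd p)) (\<rho> k))" for k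
  have cover: "B \<subseteq> T k" if "k > 0" for k
  proof
    fix d assume "d \<in> B"
    then obtain w i x where w: "w \<in> words_near d0 e k" "i \<le> n" "x \<in> {0..1}" "follow d w x = c i"
      using follow_hits_breakpoint unfolding B_def by blast
    have len: "length w = k" using w by (simp add: words_near_def)
    have sp: "s \<le> speed k" using speed_lower[OF that] by (simp add: s_def)
    have "centre w i - d = lam ^ k * x / speed k"
      using w(4) \<beta>[of d w x] len sp s unfolding centre_def by (simp add: field_simps)
    also have "\<bar>\<dots>\<bar> = \<bar>lam\<bar> ^ k * x / speed k"
      using w(3) sp s by (simp add: abs_mult power_abs)
    also have "\<dots> \<le> \<bar>lam\<bar> ^ k / s"
      using w(3) sp s by (intro frac_le) (auto simp: mult_left_le)
    finally have "d \<in> cball (centre w i) (\<rho> k)" by (simp add: dist_real_def \<rho>_def)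
    then show "d \<in> T k" using w unfolding T_def by force
  qed
  have T_measurable: "T k \<in> lmeasurable" for k
    unfolding T_def by (intro fmeasurable.finite_UN finite_cartesian_product finite_words_near) auto
  have T_measure: "measure lebesgue (T (K + j * N)) \<le> C * (n + 1) * 2 / s * \<bar>lam\<bar> ^ K * (2 * \<bar>lam\<bar> ^ N) ^ j" for j
  proof -
    let ?k = "K + j * N"
    have ball: "measure lebesgue (cball z (\<rho> k)) = 2 * \<rho> k" for z :: real and k
      using s by (simp add: cball_eq_atLeastAtMost \<rho>_def)
    have "measure lebesgue (T ?k) \<le> (\<Sum>p\<in>words_near d0 e ?k \<times> {..n}. measure lebesgue (cball (centre (fst p) (snd p)) (\<rho> ?k)))"
      unfolding T_def by (intro measure_UNION_le finite_cartesian_product finite_words_near) auto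
    also have "\<dots> = real (card (words_near d0 e ?k)) * real (n + 1) * (2 * \<rho> ?k)"
      unfolding ball by (simp add: card_cartesian_product algebra_simps)
    also have "\<dots> \<le> real (C * 2 ^ j) * real (n + 1) * (2 * \<rho> ?k)"
      using s by (intro mult_right_mono of_nat_mono e(2)) (auto simp: \<rho>_def)
    also have "real (C * 2 ^ j) * real (n + 1) * (2 * \<rho> ?k)
        = C * (n + 1) * 2 / s * \<bar>lam\<bar> ^ K * (2 * \<bar>lam\<bar> ^ N) ^ j"
      by (simp add: \<rho>_def power_add power_mult power_mult_distrib mult.commute[of j N] algebra_simps
          add_divide_distrib)
    finally show ?thesis .
  qed
  have "(\<lambda>j. C * (n + 1) * 2 / s * \<bar>lam\<bar> ^ K * (2 * \<bar>lam\<bar> ^ N) ^ j) \<longlonglongrightarrow> C * (n + 1) * 2 / s * \<bar>lam\<bar> ^ K * 0"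
    using N by (intro tendsto_intros LIMSEQ_realpow_zero) auto
  then have small: "\<exists>J. \<forall>j\<ge>J. C * (n + 1) * 2 / s * \<bar>lam\<bar> ^ K * (2 * \<bar>lam\<bar> ^ N) ^ j < \<eta>" if "\<eta> > 0" for \<eta>
    using order_tendstoD(2)[of _ 0 sequentially \<eta>] that by (simp add: eventually_sequentially)
  have "negligible B"
    unfolding negligible_outer_le
  proof (intro allI impI)
    fix \<eta> :: real assume "\<eta> > 0"
    then obtain J where J: "\<forall>j\<ge>J. C * (n + 1) * 2 / s * \<bar>lam\<bar> ^ K * (2 * \<bar>lam\<bar> ^ N) ^ j < \<eta>"
      using small by blast
    \<comment> \<open>The successor makes the length positive, as the lower bound on the speed requires.\<close>
    let ?k = "K + Suc J * N"
    have "measure lebesgue (T ?k) \<le> \<eta>" using T_measure[of "Suc J"] J[rule_format, of "Suc J"] by simp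
    moreover have "?k > 0" using \<open>N > 0\<close> by simp
    ultimately show "\<exists>T. B \<subseteq> T \<and> T \<in> lmeasurable \<and> measure lebesgue T \<le> \<eta>"
      by (intro exI[of _ "T ?k"] conjI cover T_measurable)
  qed
  then show ?thesis using e(1) that unfolding B_def by simp
qed

lemma AE_eventually_away: "AE d in lebesgue. eventually_away d"
proof -
  define B where "B = {d. generic d \<and> \<not> eventually_away d}"
  have "negligible B"
  proof (subst locally_negligible_alt, rule ballI)
    fix d0 assume "d0 \<in> B"
    then obtain e where e: "e > 0" "negligible {d. \<bar>d - d0\<bar> < e \<and> \<not> eventually_away d}"
      using negligible_not_eventually_away_near_generic unfolding B_def by blast
    have "negligible (B \<inter> ball d0 e)"
      by (rule negligible_subset[OF e(2)]) (auto simp: B_def dist_real_def)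
    then show "\<exists>U. openin (top_of_set B) U \<and> d0 \<in> U \<and> negligible U"
      using \<open>d0 \<in> B\<close> e(1) by (intro exI[of _ "B \<inter> ball d0 e"]) (auto simp: openin_open_Int)
  qed
  moreover have "negligible {d. \<not> generic d}"
    unfolding negligible_iff_null_sets
    by (intro null_sets_completionI countable_imp_null_set_lborel countable_not_generic)
  ultimately have "negligible (B \<union> {d. \<not> generic d})" by (rule negligible_Un)
  then have "B \<union> {d. \<not> generic d} \<in> null_sets lebesgue" by (simp add: negligible_iff_null_sets)
  then show ?thesis by (rule AE_I') (auto simp: B_def)
qed


section \<open>Orbits that keep a distance from the breakpoints\<close>

definition orbit_avoids :: "real \<Rightarrow> real \<Rightarrow> real \<Rightarrow> bool" where
  "orbit_avoids d r x \<longleftrightarrow> x \<in> {0..<1} \<and> (\<forall>j. \<forall>i\<le>n. r \<le> \<bar>(g d ^^ j) x - c i\<bar>)"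

lemma g_range: "g d x \<in> {0..<1}"
  by (simp add: shift_mod1_def frac_lt_1)

lemma iterate_range: "x \<in> {0..<1} \<Longrightarrow> (g d ^^ k) x \<in> {0..<1}"
  using g_range by (cases k) auto

lemma orbit_avoids_iterate:
  assumes "orbit_avoids d r x" shows "orbit_avoids d r ((g d ^^ k) x)"
proof -
  have "(g d ^^ j) ((g d ^^ k) x) = (g d ^^ (j + k)) x" for j by (simp add: funpow_add)
  then show ?thesis using assms iterate_range[where x = x and d = d and k = k] unfolding orbit_avoids_def by metis
qed

text \<open>
  No breakpoint separates \<open>x\<close> and \<open>y\<close>, so both lie in one piece. The image of \<open>x\<close> has distance at least
  \<open>r\<close> from \<open>0 = c 0\<close> and \<open>1 = c n\<close>, so the same integer is subtracted from both images.
\<close>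

lemma shadow_step:
  assumes orbit_avoids: "orbit_avoids d r x" and y: "\<bar>y - x\<bar> < r"
  shows "y \<in> {0..<1}" "g d y = g d x + lam * (y - x)"
proof -
  have x: "x \<in> {0..<1}" and rx: "\<And>i. i \<le> n \<Longrightarrow> r \<le> \<bar>x - c i\<bar>"
    and rgx: "\<And>i. i \<le> n \<Longrightarrow> r \<le> \<bar>g d x - c i\<bar>"
    using orbit_avoids unfolding orbit_avoids_def by (auto dest: spec[of _ 0] spec[of _ 1])
  obtain i where i: "i \<in> {1..n}" "c (i - 1) \<le> x" "x < c i"
    using piece_exists x by auto
  then have "i \<le> n" "i - 1 \<le> n" by auto
  then have y_piece: "c (i - 1) \<le> y" "y < c i" using rx[of i] rx[of "i - 1"] y i by linarith+
  then show "y \<in> {0..<1}" using c_range(1)[of "i - 1"] c_range(2)[of i] \<open>i \<le> n\<close> \<open>i - 1 \<le> n\<close> by simp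
  have f: "f y - f x = lam * (y - x)" using f_piece[of i x] f_piece[of i y] i y_piece
    by (simp add: algebra_simps)
  have "\<bar>lam * (y - x)\<bar> < r"
    using y lam mult_right_mono[of "\<bar>lam\<bar>" 1 "\<bar>y - x\<bar>"] by (simp add: abs_mult)
  moreover have "r \<le> g d x" "r \<le> 1 - g d x"
    using rgx[of 0] rgx[of n] c_0 c_n g_range[of d x] by auto
  ultimately have "0 \<le> g d x + lam * (y - x)" "g d x + lam * (y - x) < 1" by linarith+
  moreover have "f y + d - (g d x + lam * (y - x)) = of_int \<lfloor>f x + d\<rfloor>"
    using f by (simp add: shift_mod1_def frac_def)
  ultimately show "g d y = g d x + lam * (y - x)"
    unfolding shift_mod1_def[of f d y] by (subst frac_unique_iff) auto
qed

lemma shadow: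
  assumes "orbit_avoids d r x" "\<bar>y - x\<bar> < r"
  shows "(g d ^^ j) y = (g d ^^ j) x + lam ^ j * (y - x)"
proof (induction j)
  case (Suc j)
  have "\<bar>lam ^ j\<bar> \<le> 1" using lam by (simp add: power_abs power_le_one)
  then have "\<bar>(g d ^^ j) y - (g d ^^ j) x\<bar> < r"
    using assms(2) mult_right_mono[of "\<bar>lam ^ j\<bar>" 1 "\<bar>y - x\<bar>"] Suc by (simp add: abs_mult)
  from shadow_step(2)[OF orbit_avoids_iterate[OF assms(1)] this] show ?case
    using Suc by simp
qed simp

lemma eventually_away_orbit_avoids:
  assumes "eventually_away d"
  obtains k r where "r > 0" "\<And>x. x \<in> {0..<1} \<Longrightarrow> orbit_avoids d r ((g d ^^ k) x)"
proof -
  obtain k r where kr: "r > 0" "\<forall>x\<in>{0..<1}. \<forall>i\<le>n. r \<le> \<bar>(g d ^^ k) x - c i\<bar>"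
    using assms unfolding eventually_away_def by blast
  have "orbit_avoids d r ((g d ^^ k) x)" if x: "x \<in> {0..<1}" for x
  proof -
    have "(g d ^^ j) ((g d ^^ k) x) = (g d ^^ k) ((g d ^^ j) x)" for j
      by (metis add.commute comp_apply funpow_add)
    then show ?thesis unfolding orbit_avoids_def using kr(2) iterate_range x by simp
  qed
  then show ?thesis using that kr(1) by blast
qed

lemma close_return:
  fixes s :: "nat \<Rightarrow> real"
  assumes "range s \<subseteq> {0..<1}" "\<eta> > 0"
  obtains p q where "p < q" "\<bar>s q - s p\<bar> < \<eta>"
proof -
  have "s i \<in> {0..<1}" for i using assms(1) by blast
  then have "\<forall>i. s i \<in> {0..1}" by (simp add: less_imp_le)
  then obtain l \<sigma> where "strict_mono \<sigma>" "(s \<circ> \<sigma>) \<longlonglongrightarrow> l"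
    using compact_imp_seq_compact[OF compact_Icc, of 0 1] unfolding seq_compact_def by metis
  then have "Cauchy (s \<circ> \<sigma>)" by (simp add: LIMSEQ_imp_Cauchy)
  then obtain M where "\<forall>i\<ge>M. \<forall>j\<ge>M. dist ((s \<circ> \<sigma>) i) ((s \<circ> \<sigma>) j) < \<eta>"
    using assms(2) unfolding Cauchy_def by blast
  then have "\<bar>s (\<sigma> (Suc M)) - s (\<sigma> M)\<bar> < \<eta>" by (simp add: dist_real_def)
  moreover have "\<sigma> M < \<sigma> (Suc M)" using \<open>strict_mono \<sigma>\<close> by (simp add: strict_mono_Suc_iff)
  ultimately show ?thesis using that by blast
qed

text \<open>
  Let the orbit return from \<open>y\<close> to within \<open>\<Delta>\<close> after \<open>T\<close> steps. The return map acts near \<open>y\<close> as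
  \<open>y + v \<mapsto> y + \<Delta> + lam ^ T * v\<close>, whose fixed point is at \<open>v = \<Delta> / (1 - lam ^ T)\<close>. If the
  return is close enough, \<open>\<bar>v\<bar> < r\<close>, and the fixed point shadows the orbit of \<open>y\<close>.
\<close>

lemma attracted_to_periodic_point:
  assumes "orbit_avoids d r x" "r > 0"
  obtains z a T where "z \<in> {0..<1}" "T > 0" "(g d ^^ T) z = z"
    "(\<lambda>j. (g d ^^ (j + a)) x - (g d ^^ j) z) \<longlonglongrightarrow> 0"
proof -
  have "range (\<lambda>j. (g d ^^ j) x) \<subseteq> {0..<1}"
    using assms(1) iterate_range unfolding orbit_avoids_def by blast
  moreover have "r * (1 - \<bar>lam\<bar>) > 0" using assms(2) lam by simp
  ultimately obtain p q where pq: "p < q" "\<bar>(g d ^^ q) x - (g d ^^ p) x\<bar> < r * (1 - \<bar>lam\<bar>)"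
    by (rule close_return)
  define y T where "y = (g d ^^ p) x" and "T = q - p"
  define \<Delta> where "\<Delta> = (g d ^^ T) y - y"
  define z where "z = y + \<Delta> / (1 - lam ^ T)"
  have T: "T > 0" using pq by (simp add: T_def)
  have "T + p = q" using pq(1) by (simp add: T_def)
  then have "(g d ^^ T) y = (g d ^^ q) x" unfolding y_def by (metis comp_apply funpow_add)
  then have \<Delta>: "\<bar>\<Delta>\<bar> < r * (1 - \<bar>lam\<bar>)" using pq by (simp add: \<Delta>_def y_def)
  have gap: "1 - \<bar>lam\<bar> \<le> 1 - lam ^ T" "0 < 1 - \<bar>lam\<bar>"
    using abs_lam_power_le[OF T] lam by linarith+
  have "\<bar>\<Delta>\<bar> < r * (1 - lam ^ T)"
    using \<Delta> mult_left_mono[OF gap(1), of r] assms(2) by linarith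
  then have zy: "\<bar>z - y\<bar> < r"
    using gap unfolding z_def by (simp add: abs_divide field_simps)
  have y: "orbit_avoids d r y" using orbit_avoids_iterate[OF assms(1)] by (simp add: y_def)
  note shadow_z = shadow[OF y zy]
  have "(g d ^^ T) z = y + \<Delta> + lam ^ T * (\<Delta> / (1 - lam ^ T))"
    unfolding shadow_z by (simp add: \<Delta>_def z_def)
  also have "\<dots> = z" using gap unfolding z_def by (simp add: field_simps)
  finally have "(g d ^^ T) z = z" .
  moreover have "(\<lambda>j. (g d ^^ (j + p)) x - (g d ^^ j) z) \<longlonglongrightarrow> 0"
  proof -
    have "(\<lambda>j. - (lam ^ j * (z - y))) \<longlonglongrightarrow> - (0 * (z - y))"
      using lam by (intro tendsto_intros LIMSEQ_power_zero) auto
    moreover have "(g d ^^ (j + p)) x - (g d ^^ j) z = - (lam ^ j * (z - y))" for j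
      using shadow_z by (simp add: funpow_add y_def)
    ultimately show ?thesis by simp
  qed
  ultimately show ?thesis using that[of z T p] T shadow_step(1)[OF y zy] by blast
qed

end

section \<open>Periodic orbits as limit sets\<close>

lemma forward_orbit_periodic:
  assumes "(h ^^ T) z = z" "T > 0"
  shows "forward_orbit h z = (\<lambda>k. (h ^^ k) z) ` {..<T}"
proof -
  have "(h ^^ k) z \<in> (\<lambda>k. (h ^^ k) z) ` {..<T}" for k
    using funpow_mod_eq[OF assms(1), of k] assms(2) by (metis image_eqI lessThan_iff mod_less_divisor)
  then show ?thesis unfolding forward_orbit_def by auto
qed

lemma forward_orbit_eq_of_mem:
  assumes "(h ^^ T) z = z" "T > 0" "y \<in> forward_orbit h z"
  shows "forward_orbit h y = forward_orbit h z" "(h ^^ T) y = y"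
proof -
  obtain k where k: "y = (h ^^ k) z" using assms(3) unfolding forward_orbit_def by auto
  have shift: "(h ^^ i) y = (h ^^ (i + k)) z" for i by (simp add: k funpow_add)
  \<comment> \<open>From \<open>y\<close>, another \<open>T - k mod T\<close> steps complete the current period.\<close>
  have wrap: "(h ^^ (i + (T - k mod T))) y = (h ^^ i) z" for i
  proof -
    have "i + (T - k mod T) + k = i + (k div T + 1) * T"
      using mod_less_divisor[OF assms(2), of k] div_mult_mod_eq[of k T]
      unfolding distrib_right by linarith
    then show ?thesis unfolding shift
      using funpow_mod_eq[OF assms(1), of "i + (k div T + 1) * T"] funpow_mod_eq[OF assms(1), of i]
      by (metis mod_mult_self1)
  qed
  show "forward_orbit h y = forward_orbit h z"
  proof
    show "forward_orbit h y \<subseteq> forward_orbit h z" unfolding forward_orbit_def using shift by auto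
    show "forward_orbit h z \<subseteq> forward_orbit h y" unfolding forward_orbit_def
      using wrap by (auto simp: eq_commute)
  qed
  show "(h ^^ T) y = y" unfolding shift unfolding k
    using funpow_mod_eq[OF assms(1), of k] funpow_mod_eq[OF assms(1), of "T + k"] by simp
qed

text \<open>
  The orbit of \<open>z\<close> is finite, hence closed, so no point outside it is a limit; and each of its points
  recurs with period \<open>T\<close>, so it is approached infinitely often by the orbit of \<open>x\<close>.
\<close>

lemma omega_limit_of_asymptotic:
  fixes h :: "real \<Rightarrow> real"
  assumes z: "(h ^^ T) z = z" "T > 0"
    and lim: "(\<lambda>j. (h ^^ (j + a)) x - (h ^^ j) z) \<longlonglongrightarrow> 0"
  shows "omega_limit h x = forward_orbit h z"
proof (intro equalityI subsetI)
  fix y assume "y \<in> forward_orbit h z"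
  then obtain s where s: "y = (h ^^ s) z" unfolding forward_orbit_def by auto
  have "y \<in> closure (\<Union>k\<in>{m..}. {(h ^^ k) x})" for m
    unfolding closure_approachable
  proof (intro allI impI)
    fix e :: real assume "e > 0"
    then obtain J where J: "\<forall>j\<ge>J. \<bar>(h ^^ (j + a)) x - (h ^^ j) z\<bar> < e"
      using LIMSEQ_D[OF lim] by auto
    let ?j = "s + (J + m) * T"
    have "J + m \<le> ?j" using assms(2) by (simp add: trans_le_add2)
    moreover have "(h ^^ ?j) z = y"
      using funpow_mod_eq[OF z(1), of ?j] funpow_mod_eq[OF z(1), of s] s by simp
    ultimately have "dist ((h ^^ (?j + a)) x) y < e" using J[rule_format, of ?j]
      by (simp add: dist_real_def)
    moreover have "?j + a \<in> {m..}" using \<open>J + m \<le> ?j\<close> by simp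
    ultimately show "\<exists>w\<in>\<Union>k\<in>{m..}. {(h ^^ k) x}. dist w y < e" by blast
  qed
  then show "y \<in> omega_limit h x" unfolding omega_limit_def by blast
next
  fix y assume y: "y \<in> omega_limit h x"
  have "finite (forward_orbit h z)" using forward_orbit_periodic[OF z] by simp
  then have closed: "closed (forward_orbit h z)" by (rule finite_imp_closed)
  have "y \<in> closure (forward_orbit h z)"
    unfolding closure_approachable
  proof (intro allI impI)
    fix e :: real assume "e > 0"
    then have "e / 2 > 0" by simp
    then obtain J where J: "\<forall>j\<ge>J. \<bar>(h ^^ (j + a)) x - (h ^^ j) z\<bar> < e / 2"
      using LIMSEQ_D[OF lim] by (metis diff_zero real_norm_def)
    have "y \<in> closure (\<Union>k\<in>{J + a..}. {(h ^^ k) x})" using y unfolding omega_limit_def by blast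
    then obtain k where k: "k \<ge> J + a" "dist ((h ^^ k) x) y < e / 2"
      using \<open>e / 2 > 0\<close> unfolding closure_approachable by blast
    have "\<bar>(h ^^ k) x - (h ^^ (k - a)) z\<bar> < e / 2" using J[rule_format, of "k - a"] k by simp
    then have "dist ((h ^^ (k - a)) z) y < e" using k(2) unfolding dist_real_def by linarith
    then show "\<exists>w\<in>forward_orbit h z. dist w y < e" unfolding forward_orbit_def by blast
  qed
  then show "y \<in> forward_orbit h z" using closed by simp
qed

context piecewise_contraction
begin

lemma eventually_away_asymptotically_periodic:
  assumes "eventually_away d" shows "asymptotically_periodic (g d)"
  unfolding asymptotically_periodic_def
proof
  fix x :: real assume x: "x \<in> {0..<1}"
  obtain k r where kr: "r > 0" "\<And>x. x \<in> {0..<1} \<Longrightarrow> orbit_avoids d r ((g d ^^ k) x)"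
    using eventually_away_orbit_avoids[OF assms] by blast
  obtain z a T where z: "z \<in> {0..<1}" "T > 0" "(g d ^^ T) z = z"
    "(\<lambda>j. (g d ^^ (j + a)) ((g d ^^ k) x) - (g d ^^ j) z) \<longlonglongrightarrow> 0"
    using attracted_to_periodic_point[OF kr(2)[OF x] kr(1)] by blast
  have "(\<lambda>j. (g d ^^ (j + (a + k))) x - (g d ^^ j) z) \<longlonglongrightarrow> 0"
    using z(4) by (simp add: funpow_add add.assoc)
  then have "omega_limit (g d) x = forward_orbit (g d) z"
    using omega_limit_of_asymptotic[of T "g d" z "a + k" x] z by blast
  moreover have "\<exists>k\<ge>1. (g d ^^ k) z = z" using z by (intro exI[of _ T]) auto
  ultimately show "omega_limit (g d) x \<in> periodic_orbits (g d)"
    unfolding periodic_orbits_def using z(1) by blast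
qed

section \<open>Counting periodic orbits by sides of breakpoints\<close>

text \<open>
  The pair \<open>(i, True)\<close> stands for the right side of \<open>c i\<close> and \<open>(i, False)\<close> for its left side. The
  left side of \<open>c 0\<close> and the right side of \<open>c n\<close> lie outside the unit interval.
\<close>

definition sides :: "(nat \<times> bool) set" where
  "sides = {..<n} \<times> {True} \<union> {1..n} \<times> {False}"

fun side_interval :: "nat \<times> bool \<Rightarrow> real \<Rightarrow> real set" where
  "side_interval (i, True) p = {c i<..p}"
| "side_interval (i, False) p = {p..<c i}"

lemma finite_sides: "finite sides" and card_sides: "card sides = 2 * n"
proof -
  show "finite sides" by (simp add: sides_def)
  have "card sides = card ({..<n} \<times> {True}) + card ({1..n} \<times> {False})"
    unfolding sides_def by (rule card_Un_disjoint) auto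
  then show "card sides = 2 * n" by (simp add: card_cartesian_product)
qed

text \<open>
  Choose \<open>p\<close> on the orbit and a breakpoint \<open>c i\<close> at the smallest possible distance \<open>r\<close>. The whole orbit
  of \<open>p\<close> then keeps distance \<open>r\<close> from the breakpoints, and every point strictly between \<open>c i\<close>
  and \<open>p\<close> is closer than \<open>r\<close> to \<open>p\<close>, so it shadows \<open>p\<close>.
\<close>

lemma periodic_orbit_attracts_side:
  assumes "eventually_away d" "\<gamma> \<in> periodic_orbits (g d)"
  shows "\<exists>p T \<sigma>. \<gamma> = forward_orbit (g d) p \<and> T > 0 \<and> (g d ^^ T) p = p \<and> \<sigma> \<in> sides \<and>
    p \<in> side_interval \<sigma> p \<and>
    (\<forall>y\<in>side_interval \<sigma> p. \<forall>j. (g d ^^ j) y = (g d ^^ j) p + lam ^ j * (y - p))"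
proof -
  obtain x T where x: "\<gamma> = forward_orbit (g d) x" "x \<in> {0..<1}" "T > 0" "(g d ^^ T) x = x"
    using assms(2) unfolding periodic_orbits_def by (auto simp: Suc_le_eq)
  obtain k r0 where kr: "r0 > 0" "\<And>x. x \<in> {0..<1} \<Longrightarrow> orbit_avoids d r0 ((g d ^^ k) x)"
    using eventually_away_orbit_avoids[OF assms(1)] by blast
  \<comment> \<open>A periodic point is in the range of every iterate, so it inherits the uniform distance.\<close>
  have avoids_\<gamma>: "orbit_avoids d r0 p" if "p \<in> \<gamma>" for p
  proof -
    have p: "(g d ^^ T) p = p" using forward_orbit_eq_of_mem(2)[of T "g d" x p] that x by blast
    have pI: "p \<in> {0..<1}" using that x iterate_range by (auto simp: forward_orbit_def)
    have "(g d ^^ (k * T)) p = p" using funpow_mod_eq[OF p, of "k * T"] by simp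
    moreover have "k * T = (k * T - k) + k" using x(3) by simp
    ultimately have "(g d ^^ (k * T - k)) ((g d ^^ k) p) = p"
      by (metis comp_apply funpow_add)
    then show ?thesis using orbit_avoids_iterate[OF kr(2)[OF pI], of "k * T - k"] by simp
  qed
  have fin: "finite (\<gamma> \<times> {..n})" "\<gamma> \<times> {..n} \<noteq> {}"
    using x forward_orbit_periodic[OF x(4,3)] by auto
  define q where "q = arg_min_on (\<lambda>q. \<bar>fst q - c (snd q)\<bar>) (\<gamma> \<times> {..n})"
  have q_mem: "q \<in> \<gamma> \<times> {..n}" unfolding q_def by (rule arg_min_if_finite(1)[OF fin])
  have q_min: "\<bar>fst q - c (snd q)\<bar> \<le> \<bar>fst q' - c (snd q')\<bar>" if "q' \<in> \<gamma> \<times> {..n}" for q'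
    unfolding q_def by (rule arg_min_least[OF fin that])
  obtain p i where pi: "q = (p, i)" by force
  define r where "r = \<bar>p - c i\<bar>"
  have p: "p \<in> \<gamma>" "i \<le> n" using q_mem pi by auto
  have p_period: "(g d ^^ T) p = p" "forward_orbit (g d) p = \<gamma>"
    using forward_orbit_eq_of_mem[of T "g d" x p] p x by auto
  have pI: "p \<in> {0..<1}" using avoids_\<gamma>[OF p(1)] by (simp add: orbit_avoids_def)
  have avoids_p: "orbit_avoids d r p"
    unfolding orbit_avoids_def
  proof (intro conjI allI impI pI)
    fix j i' assume "i' \<le> n"
    have "(g d ^^ j) p \<in> \<gamma>" using p_period(2) by (auto simp: forward_orbit_def)
    then show "r \<le> \<bar>(g d ^^ j) p - c i'\<bar>"
      using q_min[of "((g d ^^ j) p, i')"] pi \<open>i' \<le> n\<close> by (simp add: r_def)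
  qed
  have "r0 \<le> r" using avoids_\<gamma>[OF p(1)] p(2) unfolding orbit_avoids_def r_def
    by (auto dest: spec[of _ 0])
  then have "p \<noteq> c i" using kr(1) by (auto simp: r_def)
  define \<sigma> where "\<sigma> = (i, c i < p)"
  have "\<sigma> \<in> sides"
    using \<open>p \<noteq> c i\<close> pI p(2) c_0 c_n unfolding \<sigma>_def sides_def
    by (cases "i = n"; cases "i = 0") (auto simp: not_less)
  moreover have "p \<in> side_interval \<sigma> p" using \<open>p \<noteq> c i\<close> unfolding \<sigma>_def
    by (cases "c i < p") auto
  moreover have "\<bar>y - p\<bar> < r" if "y \<in> side_interval \<sigma> p" for y
    using that \<open>p \<noteq> c i\<close> unfolding \<sigma>_def r_def by (cases "c i < p") auto
  then have "\<forall>y\<in>side_interval \<sigma> p. \<forall>j. (g d ^^ j) y = (g d ^^ j) p + lam ^ j * (y - p)"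
    using shadow[OF avoids_p] by blast
  ultimately show ?thesis using p_period x(3) by blast
qed

text \<open>
  After a common period both points are back, while their difference has been multiplied by a power
  of \<open>lam\<close>, which is less than \<open>1\<close>.
\<close>

lemma periodic_points_eq_of_contracted_difference:
  assumes "T > 0" "(g d ^^ T) p = p" "T' > 0" "(g d ^^ T') p' = p'"
    and "(g d ^^ (T * T')) p' = (g d ^^ (T * T')) p + lam ^ (T * T') * (p' - p)"
  shows "p = p'"
proof -
  have "(g d ^^ (T * T')) p = p" using funpow_mod_eq[OF assms(2), of "T * T'"] by simp
  moreover have "(g d ^^ (T * T')) p' = p'" using funpow_mod_eq[OF assms(4), of "T * T'"] by simp
  ultimately have "(1 - lam ^ (T * T')) * (p' - p) = 0" using assms(5) by (simp add: algebra_simps)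
  moreover have "lam ^ (T * T') < 1" using abs_lam_power_le[of "T * T'"] lam assms by force
  ultimately show ?thesis by simp
qed

text \<open>
  If two orbits were assigned the same side of the same breakpoint, the point nearer to the
  breakpoint would lie in the interval attracted to the other one, and the orbits would coincide.
\<close>

lemma card_periodic_orbits:
  assumes "eventually_away d"
  shows "finite (periodic_orbits (g d))" "card (periodic_orbits (g d)) \<le> 2 * n"
proof -
  obtain P T \<sigma> where P: "\<And>\<gamma>. \<gamma> \<in> periodic_orbits (g d) \<Longrightarrow> \<gamma> = forward_orbit (g d) (P \<gamma>)"
    "\<And>\<gamma>. \<gamma> \<in> periodic_orbits (g d) \<Longrightarrow> T \<gamma> > 0 \<and> (g d ^^ T \<gamma>) (P \<gamma>) = P \<gamma>"
    "\<And>\<gamma>. \<gamma> \<in> periodic_orbits (g d) \<Longrightarrow> \<sigma> \<gamma> \<in> sides \<and> P \<gamma> \<in> side_interval (\<sigma> \<gamma>) (P \<gamma>)"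
    "\<And>\<gamma> y j. \<gamma> \<in> periodic_orbits (g d) \<Longrightarrow> y \<in> side_interval (\<sigma> \<gamma>) (P \<gamma>) \<Longrightarrow>
       (g d ^^ j) y = (g d ^^ j) (P \<gamma>) + lam ^ j * (y - P \<gamma>)"
    using periodic_orbit_attracts_side[OF assms] by metis
  \<comment> \<open>Two intervals ending at the same side of a breakpoint are nested.\<close>
  have nested: "P \<gamma> \<in> side_interval (\<sigma> \<gamma>') (P \<gamma>') \<or> P \<gamma>' \<in> side_interval (\<sigma> \<gamma>) (P \<gamma>)"
    if "\<gamma> \<in> periodic_orbits (g d)" "\<gamma>' \<in> periodic_orbits (g d)" "\<sigma> \<gamma> = \<sigma> \<gamma>'" for \<gamma> \<gamma>'
    using P(3)[OF that(1)] P(3)[OF that(2)] that(3)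
    by (cases "(\<sigma> \<gamma>, P \<gamma>)" rule: side_interval.cases) auto
  have "inj_on \<sigma> (periodic_orbits (g d))"
  proof (rule inj_onI)
    fix \<gamma> \<gamma>' assume *: "\<gamma> \<in> periodic_orbits (g d)" "\<gamma>' \<in> periodic_orbits (g d)" "\<sigma> \<gamma> = \<sigma> \<gamma>'"
    have "P \<gamma> = P \<gamma>'"
      using nested[OF *] P(2)[OF *(1)] P(2)[OF *(2)] P(4)[OF *(1)] P(4)[OF *(2)]
        periodic_points_eq_of_contracted_difference by metis
    then show "\<gamma> = \<gamma>'" using P(1) * by metis
  qed
  moreover have "\<sigma> ` periodic_orbits (g d) \<subseteq> sides" using P(3) by blast
  ultimately show "finite (periodic_orbits (g d))" "card (periodic_orbits (g d)) \<le> 2 * n"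
    using finite_sides card_sides inj_on_finite card_inj_on_le by metis+
qed

end

theorem theorem1p1:
  fixes n :: nat and lam :: real and f :: "real \<Rightarrow> real"
  assumes "n \<ge> 1"
    and "-1 < lam" and "lam < 1"
    and "piecewise_affine n lam f"
  shows "AE \<delta> in lebesgue.
           asymptotically_periodic (shift_mod1 f \<delta>) \<and>
           finite (periodic_orbits (shift_mod1 f \<delta>)) \<and>
           card (periodic_orbits (shift_mod1 f \<delta>)) \<le> 2 * n"
proof -
  obtain c b :: "nat \<Rightarrow> real" where cb: "c 0 = 0" "c n = 1" "\<forall>i\<in>{1..n}. c (i - 1) < c i"
    "\<forall>i\<in>{1..n}. \<forall>x\<in>{c (i - 1)..<c i}. f x = lam * x + b i"
    using assms(4) unfolding piecewise_affine_def by blast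
  interpret piecewise_contraction n lam c b f
    by unfold_locales (use assms cb in auto)
  show ?thesis
    using AE_eventually_away
    by (rule AE_mp) (simp add: eventually_away_asymptotically_periodic card_periodic_orbits)
qed

end
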